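(* Let $S$ be a commutative semiring with $1\neq 0$ and let $M$ be a unital $S$-semimodule. If $N$ is a $1$-absorbing prime subsemimodule of $M$, then $(N:_S M)$ is a $1$-absorbing prime ideal of $S$.
   Context: For a subsemimodule $N$ of $M$, $(N:_S M)=\{s\in S\mid sM\subseteq N\}$, an ideal of $S$. A proper subsemimodule $N$ of $M$ is $1$-absorbing prime if for all nonunits $a,b\in S$ and all $m\in M$, $abm\in N$ implies $ab\in (N:_S M)$ or $m\in N$. A proper ideal $I$ of $S$ is $1$-absorbing prime if for all nonunits $a,b,c\in S$, $abc\in I$ implies $ab\in I$ or $c\in I$. *)

theory Defs
  imports Main
begin

text \<open>The class \<^class>\<open>comm_semiring_1\<close> includes both \<open>0 * a = 0\<close> and \<open>0 \<noteq> 1\<close>.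
  Without additive inverses, \<open>scale_zero_left\<close> does not follow from the distributivity
  laws and has to be an axiom. A nonunit is an element that does not divide 1; the library abbreviation
  \<open>is_unit\<close> is restricted to classes without zero divisors.\<close>

locale semimodule =
  fixes scale :: "'s::comm_semiring_1 \<Rightarrow> 'm::comm_monoid_add \<Rightarrow> 'm"  (infixr \<open>*s\<close> 75)
  assumes scale_right_distrib: "a *s (x + y) = a *s x + a *s y"
    and scale_left_distrib: "(a + b) *s x = a *s x + b *s x"
    and scale_scale: "a *s (b *s x) = (a * b) *s x"
    and scale_one: "1 *s x = x"
    and scale_zero_left: "0 *s x = 0"
    and scale_zero_right: "a *s 0 = 0"
begin

definition subsemimodule :: "'m set \<Rightarrow> bool" where
  "subsemimodule N \<longleftrightarrow>
     0 \<in> N \<and> (\<forall>x\<in>N. \<forall>y\<in>N. x + y \<in> N) \<and> (\<forall>s. \<forall>x\<in>N. s *s x \<in> N)"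

definition colon :: "'m set \<Rightarrow> 's set" where
  "colon N = {s. range (\<lambda>m. s *s m) \<subseteq> N}"

definition one_absorbing_prime_subsemimodule :: "'m set \<Rightarrow> bool" where
  "one_absorbing_prime_subsemimodule N \<longleftrightarrow>
     subsemimodule N \<and> N \<noteq> UNIV \<and>
     (\<forall>a b m. \<not> a dvd 1 \<longrightarrow> \<not> b dvd 1 \<longrightarrow> (a * b) *s m \<in> N \<longrightarrow>
        a * b \<in> colon N \<or> m \<in> N)"

end

definition semiring_ideal :: "'s::comm_semiring_1 set \<Rightarrow> bool" where
  "semiring_ideal I \<longleftrightarrow>
     0 \<in> I \<and> (\<forall>x\<in>I. \<forall>y\<in>I. x + y \<in> I) \<and> (\<forall>s. \<forall>x\<in>I. s * x \<in> I)"

definition one_absorbing_prime_ideal :: "'s::comm_semiring_1 set \<Rightarrow> bool" where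
  "one_absorbing_prime_ideal I \<longleftrightarrow>
     semiring_ideal I \<and> I \<noteq> UNIV \<and>
     (\<forall>a b c. \<not> a dvd 1 \<longrightarrow> \<not> b dvd 1 \<longrightarrow> \<not> c dvd 1 \<longrightarrow> a * b * c \<in> I \<longrightarrow>
        a * b \<in> I \<or> c \<in> I)"

end

theory Submission
  imports Defs
begin

text \<open>If \<open>a * b * c\<close> lies in the colon ideal, then \<open>a * b\<close> sends every multiple \<open>c *s m\<close>
  into \<open>N\<close>. The condition on \<open>N\<close>, applied to \<open>a\<close>, \<open>b\<close> and the vector \<open>c *s m\<close>, gives
  \<open>a * b \<in> colon N\<close> or \<open>c *s m \<in> N\<close>. The first alternative does not involve \<open>m\<close>, so if it
  fails then the second one holds for all \<open>m\<close> at once, and this says \<open>c \<in> colon N\<close>.\<close>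

context semimodule
begin

lemma mem_colon_iff: "s \<in> colon N \<longleftrightarrow> (\<forall>m. s *s m \<in> N)"
  by (auto simp: colon_def)

lemma semiring_ideal_colon:
  assumes "subsemimodule N"
  shows "semiring_ideal (colon N)"
  using assms
  by (auto simp: semiring_ideal_def subsemimodule_def mem_colon_iff
      scale_zero_left scale_left_distrib simp flip: scale_scale)

lemma colon_neq_UNIV:
  assumes "N \<noteq> UNIV"
  shows "colon N \<noteq> UNIV"
proof
  assume "colon N = UNIV"
  then have "1 \<in> colon N" by simp
  then have "m \<in> N" for m by (simp add: mem_colon_iff scale_one)
  with assms show False by auto
qed

lemma one_absorbing_prime_ideal_colon:
  assumes N: "one_absorbing_prime_subsemimodule N"
  shows "one_absorbing_prime_ideal (colon N)"
  unfolding one_absorbing_prime_ideal_def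
proof (intro conjI allI impI)
  show "semiring_ideal (colon N)" "colon N \<noteq> UNIV"
    using N semiring_ideal_colon colon_neq_UNIV
    by (simp_all add: one_absorbing_prime_subsemimodule_def)
next
  fix a b c
  assume nonunits: "\<not> a dvd 1" "\<not> b dvd 1" and abc: "a * b * c \<in> colon N"
  have "a * b \<in> colon N \<or> c *s m \<in> N" for m
  proof -
    have "(a * b) *s (c *s m) \<in> N"
      using abc by (simp add: mem_colon_iff scale_scale)
    with N nonunits show ?thesis
      unfolding one_absorbing_prime_subsemimodule_def by blast
  qed
  then show "a * b \<in> colon N \<or> c \<in> colon N"
    by (auto simp: mem_colon_iff[of c])
qed

end

theorem proposition2p6:
  fixes scale :: "'s::comm_semiring_1 \<Rightarrow> 'm::comm_monoid_add \<Rightarrow> 'm"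
    and N :: "'m set"
  assumes "semimodule scale"
    and "semimodule.one_absorbing_prime_subsemimodule scale N"
  shows "one_absorbing_prime_ideal (semimodule.colon scale N)"
  using assms by (rule semimodule.one_absorbing_prime_ideal_colon)

end
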